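(* We have $$\sum_{n=0}^\infty\big(q^{n(n+1)}-q^{5n(n+1)+1}\big)=\frac{(q,q^9,q^{10};q^{10})_\infty\,(q^8,q^{12};q^{20})_\infty}{(q^2,q^3;q^5)_\infty}.$$
   Context: Here $q$ is a complex number with $|q|<1$ (equivalently, the identity may be read as an identity of formal power series in $q$). For a complex number $a$, $(a;q)_\infty:=\prod_{i=0}^\infty(1-aq^i)$, and $(a_1,a_2,\dots,a_m;q)_\infty:=\prod_{j=1}^m(a_j;q)_\infty$. *)

theory Defs
  imports "HOL-Analysis.Analysis"
begin

definition qpoch_inf :: "complex \<Rightarrow> complex \<Rightarrow> complex" where
  "qpoch_inf a q = (\<Prod>i. 1 - a * q ^ i)"

definition qpochs_inf :: "complex list \<Rightarrow> complex \<Rightarrow> complex" where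
  "qpochs_inf as q = (\<Prod>a\<leftarrow>as. qpoch_inf a q)"

text \<open>
  The infinite product denotes an unspecified value if the product does not converge; for
  \<open>norm q < 1\<close> it always converges.
\<close>

lemma convergent_prod_qpoch_inf:
  fixes a q :: complex
  assumes "norm q < 1"
  shows "convergent_prod (\<lambda>i. 1 - a * q ^ i)"
proof -
  have "summable (\<lambda>i. norm (a * q ^ i))"
    using assms by (simp add: norm_mult norm_power summable_geometric summable_mult)
  hence "abs_convergent_prod (\<lambda>i. 1 - a * q ^ i)"
    by (intro summable_imp_abs_convergent_prod) simp
  thus ?thesis
    by (rule abs_convergent_prod_imp_convergent_prod)
qed

end

theory Submission
  imports Defs
begin

text \<open>
  Write \<open>[k] = (q\<^sup>k, q\<^bsup>20-k\<^esup>; q\<^bsup>20\<^esup>)\<^sub>\<infinity>\<close>. Gauss's product for \<open>\<psi>(t\<^sup>2) = \<Sum> t\<^bsup>n(n+1)\<^esup>\<close>, used for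
  \<open>t = q\<close> and \<open>t = q\<^sup>5\<close>, and dissection of all products modulo 20 turn the claim into
  \<open>[4][8][3][7] - q [2][6][3][7] = [10][1][9][6]\<close>. This is Weierstrass' three-term relation for theta
  functions at \<open>(x, y, u, v) = (q\<^sup>8, q\<^sup>4, q\<^sup>5, q\<^sup>2)\<close>. Both inputs come from the Jacobi triple product,
  which is the limit of the finite \<open>q\<close>-binomial theorem.
\<close>

subsection \<open>Sums over the integers\<close>

lemma UNIV_int_split: "(UNIV :: int set) = range int \<union> range (\<lambda>n. - 1 - int n)"
proof -
  have "l \<in> range int \<union> range (\<lambda>n. - 1 - int n)" for l :: int
  proof (cases "l \<ge> 0")
    case True
    then have "l = int (nat l)" by simp
    then show ?thesis by blast
  next
    case False
    then have "l = - 1 - int (nat (- 1 - l))" by simp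
    then show ?thesis by blast
  qed
  then show ?thesis by blast
qed

text \<open>Negative integers are enumerated as \<open>- 1 - n\<close>, so both halves run over all
  naturals. This reflection fixes \<open>l * (l + 1)\<close>, which Gauss's sum exploits
  later.\<close>

lemma has_sum_int_split:
  fixes f :: "int \<Rightarrow> 'a :: topological_comm_monoid_add"
  assumes "((\<lambda>n. f (int n)) has_sum a) UNIV" "((\<lambda>n. f (- 1 - int n)) has_sum b) UNIV"
  shows "(f has_sum (a + b)) UNIV"
proof -
  have "(f has_sum a) (range int)"
    using assms(1) by (subst has_sum_reindex) (auto simp: o_def)
  moreover have "(f has_sum b) (range (\<lambda>n. - 1 - int n))"
    using assms(2) by (subst has_sum_reindex) (auto simp: o_def inj_def)
  moreover have "range int \<inter> range (\<lambda>n. - 1 - int n) = {}"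
    by auto
  ultimately show ?thesis
    unfolding UNIV_int_split by (rule has_sum_Un_disjoint)
qed

lemma summable_on_int_split:
  fixes f :: "int \<Rightarrow> 'a :: topological_comm_monoid_add"
  assumes "(\<lambda>n. f (int n)) summable_on UNIV" "(\<lambda>n. f (- 1 - int n)) summable_on UNIV"
  shows "f summable_on UNIV"
  using assms has_sum_int_split unfolding summable_on_def by blast

text \<open>Dominated convergence over the integers, for passing from finite products to theta
  series. An absolutely summable family may be summed in any order, so the enumeration
  \<open>int_decode\<close> reduces it to Tannery's theorem for ordinary series.\<close>

lemma tannery_int:
  fixes a :: "nat \<Rightarrow> int \<Rightarrow> complex"
  assumes limit: "\<And>l. (\<lambda>n. a n l) \<longlonglongrightarrow> b l"
    and bound: "\<And>n l. norm (a n l) \<le> M l"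
    and M: "M summable_on UNIV"
  shows "(\<lambda>n. \<Sum>\<^sub>\<infinity>l. a n l) \<longlonglongrightarrow> (\<Sum>\<^sub>\<infinity>l. b l)"
proof -
  have bij: "bij_betw int_decode UNIV UNIV"
    by (rule bij_int_decode)
  have suminf: "(\<Sum>k. f (int_decode k)) = infsum f UNIV"
    if "\<And>l. norm (f l) \<le> M l" for f :: "int \<Rightarrow> complex"
  proof -
    have "(\<lambda>l. norm (f l)) summable_on UNIV"
      using M that by (rule Infinite_Sum.abs_summable_on_comparison_test')
    then have "f summable_on UNIV"
      by (rule abs_summable_summable)
    then have "((\<lambda>k. f (int_decode k)) has_sum infsum f UNIV) UNIV"
      by (subst has_sum_reindex_bij_betw[OF bij]) (rule has_sum_infsum)
    then show ?thesis
      by (rule sums_unique[OF has_sum_imp_sums, symmetric])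
  qed
  \<comment> \<open>The bound survives the limit, so \<open>suminf\<close> applies to
    \<open>b\<close> as well as to each \<open>a n\<close>.\<close>
  have b: "norm (b l) \<le> M l" for l
    using limit[of l] bound by (intro Lim_bounded[OF tendsto_norm[OF limit[of l]], of 0]) auto
  have "summable (\<lambda>k. M (int_decode k))"
    using M by (intro summable_on_imp_summable) (simp add: summable_on_reindex_bij_betw[OF bij])
  then have "(\<lambda>n. \<Sum>k. a n (int_decode k)) \<longlonglongrightarrow> (\<Sum>k. b (int_decode k))"
    using tannerys_theorem[where a = "\<lambda>k n. a n (int_decode k)" and M = "\<lambda>k. M (int_decode k)"
        and b = "\<lambda>k. b (int_decode k)" and F = sequentially] limit bound
    by (auto intro: always_eventually)
  then show ?thesis
    using suminf[OF b] suminf[of "a _", OF bound] by simp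
qed

text \<open>For complex families, summability is absolute; hence the product family is absolutely
  summable and its sum can be computed iteratively.\<close>

lemma has_sum_mult_Times:
  fixes f g :: "'a \<Rightarrow> complex"
  assumes f: "f summable_on A" and g: "g summable_on B"
  shows "((\<lambda>(x, y). f x * g y) has_sum (infsum f A * infsum g B)) (A \<times> B)"
proof -
  have "(\<lambda>z. norm (case z of (x, y) \<Rightarrow> f x * g y)) summable_on A \<times> B"
    using f g
    by (auto simp: Infinite_Sum.abs_summable_on_Sigma_iff norm_mult infsum_cmult_right' abs_mult summable_on_cmult_right
        summable_on_cmult_left summable_on_iff_abs_summable_on_complex)
  then have s: "(\<lambda>(x, y). f x * g y) summable_on A \<times> B"
    by (rule abs_summable_summable)
  show ?thesis
  proof (rule has_sum_SigmaI)
    show "((\<lambda>y. case (x, y) of (x, y) \<Rightarrow> f x * g y) has_sum f x * infsum g B) B" for x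
      using has_sum_cmult_right[OF has_sum_infsum[OF g]] by simp
    show "((\<lambda>x. f x * infsum g B) has_sum infsum f A * infsum g B) A"
      using has_sum_cmult_left[OF has_sum_infsum[OF f]] by simp
  qed (use s in simp)
qed

subsection \<open>Theta series\<close>

text \<open>Jacobi's theta function with nome \<open>p\<close> in the multiplicative variable
  \<open>w\<close>. Its product form has base \<open>p^2\<close>; taking \<open>p\<close> as the
  parameter avoids square roots.\<close>

definition jtheta :: "complex \<Rightarrow> complex \<Rightarrow> complex" where
  "jtheta p w = (\<Sum>\<^sub>\<infinity>l::int. p powi (l * l) * w powi l)"

text \<open>The \<open>n\<close>-th root of the term is \<open>r ^ n * s\<close>, which tends to 0
  however large \<open>s\<close> is, so a geometric series eventually dominates.\<close>

lemma summable_square_exponent: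
  fixes r s :: real
  assumes "0 \<le> r" "r < 1" "0 \<le> s"
  shows "summable (\<lambda>n. r ^ (n * n) * s ^ n)"
proof -
  have "(\<lambda>n. r ^ n * s) \<longlonglongrightarrow> 0"
    using assms by (intro tendsto_mult_left_zero LIMSEQ_realpow_zero) auto
  then have "eventually (\<lambda>n. r ^ n * s < 1 / 2) sequentially"
    by (rule order_tendstoD) simp
  then have "eventually (\<lambda>n. norm (r ^ (n * n) * s ^ n) \<le> (1 / 2) ^ n) sequentially"
  proof eventually_elim
    case (elim n)
    have "r ^ (n * n) * s ^ n = (r ^ n * s) ^ n"
      by (simp add: power_mult power_mult_distrib)
    also have "\<dots> \<le> (1 / 2) ^ n"
      using assms elim by (intro power_mono) auto
    finally show ?case
      using assms by simp
  qed
  then show ?thesis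
    by (rule summable_comparison_test_ev) simp
qed

lemma jtheta_abs_summable:
  fixes p w :: complex
  assumes p: "norm p < 1" "p \<noteq> 0" and w: "w \<noteq> 0"
  shows "(\<lambda>l::int. norm (p powi (l * l) * w powi l)) summable_on UNIV"
proof (rule summable_on_int_split)
  have "(\<lambda>n. norm p ^ (n * n) * norm w ^ n) summable_on UNIV"
    using p by (intro norm_summable_imp_summable_on) (auto intro: summable_square_exponent)
  moreover have "norm (p powi (int n * int n) * w powi int n) = norm p ^ (n * n) * norm w ^ n" for n
    by (simp add: norm_mult norm_power power_int_def nat_mult_distrib)
  ultimately show "(\<lambda>n. norm (p powi (int n * int n) * w powi int n)) summable_on UNIV"
    by simp
  \<comment> \<open>The terms at \<open>l = - 1 - n\<close> form the one-sided series for
    \<open>1 / w\<close> without its first term, hence the shift by \<open>Suc\<close>.\<close>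
  have "summable (\<lambda>n. norm p ^ (n * n) * inverse (norm w) ^ n)"
    using p by (intro summable_square_exponent) auto
  then have "summable (\<lambda>n. norm p ^ (Suc n * Suc n) * inverse (norm w) ^ Suc n)"
    by (subst summable_Suc_iff)
  then have "(\<lambda>n. norm p ^ (Suc n * Suc n) * inverse (norm w) ^ Suc n) summable_on UNIV"
    by (intro norm_summable_imp_summable_on) simp
  moreover have "norm (p powi ((- 1 - int n) * (- 1 - int n)) * w powi (- 1 - int n)) =
      norm p ^ (Suc n * Suc n) * inverse (norm w) ^ Suc n" for n
  proof -
    have e: "(- 1 - int n) * (- 1 - int n) = int (Suc n * Suc n)" "- 1 - int n = - int (Suc n)"
      by (simp_all add: algebra_simps)
    show ?thesis
      unfolding e(1) unfolding e(2) power_int_minus power_int_of_nat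
      by (simp only: norm_mult norm_power norm_inverse power_inverse)
  qed
  ultimately show "(\<lambda>n. norm (p powi ((- 1 - int n) * (- 1 - int n)) * w powi (- 1 - int n))) summable_on UNIV"
    by simp
qed

lemma jtheta_summable:
  fixes p w :: complex
  assumes "norm p < 1" "p \<noteq> 0" "w \<noteq> 0"
  shows "(\<lambda>l::int. p powi (l * l) * w powi l) summable_on UNIV"
  by (rule abs_summable_summable[OF jtheta_abs_summable[OF assms]])

lemma jtheta_has_sum:
  assumes "norm p < 1" "p \<noteq> 0" "w \<noteq> 0"
  shows "((\<lambda>l::int. p powi (l * l) * w powi l) has_sum jtheta p w) UNIV"
  unfolding jtheta_def using jtheta_summable[OF assms] by (rule has_sum_infsum)

text \<open>The double series over \<open>(m, n)\<close> is split by the parity of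
  \<open>m + n\<close>. The substitutions \<open>h1\<close> and \<open>h2\<close> parametrize the
  two classes and diagonalize \<open>m^2 + n^2\<close>, so that each part factors again, now with
  nome \<open>p^2\<close>.\<close>

lemma jtheta_mult:
  assumes p: "norm p < 1" "p \<noteq> 0" and a: "a \<noteq> 0" and b: "b \<noteq> 0"
  shows "jtheta p (a * b) * jtheta p (a / b) =
    jtheta (p\<^sup>2) (a\<^sup>2) * jtheta (p\<^sup>2) (b\<^sup>2) +
    p * (a * jtheta (p\<^sup>2) ((p * a)\<^sup>2)) * (b * jtheta (p\<^sup>2) ((p * b)\<^sup>2))"
proof -
  define F where "F = (\<lambda>(m::int, n::int). (p powi (m * m) * (a * b) powi m) * (p powi (n * n) * (a / b) powi n))"
  define h1 :: "int \<times> int \<Rightarrow> int \<times> int" where "h1 = (\<lambda>(i, j). (i + j, i - j))"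
  define h2 :: "int \<times> int \<Rightarrow> int \<times> int" where "h2 = (\<lambda>(i, j). (i + j + 1, i - j))"
  have p2: "norm (p\<^sup>2) < 1" "p\<^sup>2 \<noteq> 0"
    using p by (auto simp: norm_power power_less_one_iff)
  have F: "(F has_sum jtheta p (a * b) * jtheta p (a / b)) UNIV"
    using has_sum_mult_Times[OF jtheta_summable[OF p, of "a * b"] jtheta_summable[OF p, of "a / b"]] a b
    by (simp add: F_def jtheta_def)
  have F_eq: "F (m, n) = p powi (m * m + n * n) * a powi (m + n) * b powi (m - n)" for m n
    using p a b by (simp add: F_def power_int_add power_int_diff power_int_mult_distrib power_int_divide_distrib)
  have sq: "(c\<^sup>2) powi k = c powi (2 * k)" for c :: complex and k
    by (simp add: power_int_mult)
  have 1: "(F has_sum jtheta (p\<^sup>2) (a\<^sup>2) * jtheta (p\<^sup>2) (b\<^sup>2)) (range h1)"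
  proof -
    have "F (h1 (i, j)) = ((p\<^sup>2) powi (i * i) * (a\<^sup>2) powi i) * ((p\<^sup>2) powi (j * j) * (b\<^sup>2) powi j)" for i j
    proof -
      have "(i + j) * (i + j) + (i - j) * (i - j) = 2 * (i * i) + 2 * (j * j)"
        "i + j + (i - j) = 2 * i" "i + j - (i - j) = 2 * j"
        by (simp_all add: algebra_simps)
      then show ?thesis
        using p unfolding h1_def F_eq prod.case sq by (simp add: power_int_add)
    qed
    then have "F \<circ> h1 = (\<lambda>(i, j). ((p\<^sup>2) powi (i * i) * (a\<^sup>2) powi i) * ((p\<^sup>2) powi (j * j) * (b\<^sup>2) powi j))"
      by auto
    moreover have "inj h1"
      by (auto simp: inj_def h1_def)
    ultimately show ?thesis
      using has_sum_mult_Times[OF jtheta_summable[OF p2, of "a\<^sup>2"] jtheta_summable[OF p2, of "b\<^sup>2"]] a b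
      by (subst has_sum_reindex) (simp_all add: jtheta_def)
  qed
  \<comment> \<open>In the odd class the exponent of \<open>p\<close> is
    \<open>2i^2 + 2i + 2j^2 + 2j + 1\<close>: the linear terms move the arguments to
    \<open>(p * a)^2\<close> and \<open>(p * b)^2\<close>, and the constants yield the prefactor
    \<open>p * a * b\<close>.\<close>
  have 2: "(F has_sum p * (a * jtheta (p\<^sup>2) ((p * a)\<^sup>2)) * (b * jtheta (p\<^sup>2) ((p * b)\<^sup>2))) (range h2)"
  proof -
    have "F (h2 (i, j)) = p * a * b * (((p\<^sup>2) powi (i * i) * ((p * a)\<^sup>2) powi i) * ((p\<^sup>2) powi (j * j) * ((p * b)\<^sup>2) powi j))" for i j
    proof -
      have "(i + j + 1) * (i + j + 1) + (i - j) * (i - j) = 2 * (i * i) + 2 * i + 2 * (j * j) + 2 * j + 1"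
        "i + j + 1 + (i - j) = 2 * i + 1" "i + j + 1 - (i - j) = 2 * j + 1"
        by (simp_all add: algebra_simps)
      then show ?thesis
        using p a b unfolding h2_def F_eq prod.case sq by (simp add: power_int_add power_int_mult_distrib)
    qed
    then have "F \<circ> h2 = (\<lambda>z. p * a * b * (case z of (i, j) \<Rightarrow> ((p\<^sup>2) powi (i * i) * ((p * a)\<^sup>2) powi i) * ((p\<^sup>2) powi (j * j) * ((p * b)\<^sup>2) powi j)))"
      by auto
    moreover have "inj h2"
      by (auto simp: inj_def h2_def)
    moreover have "(p * a)\<^sup>2 \<noteq> 0" "(p * b)\<^sup>2 \<noteq> 0"
      using p a b by auto
    moreover note has_sum_cmult_right[OF has_sum_mult_Times[OF jtheta_summable[OF p2, of "(p * a)\<^sup>2"] jtheta_summable[OF p2, of "(p * b)\<^sup>2"]], of "p * a * b"]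
    ultimately show ?thesis
      by (subst has_sum_reindex) (simp_all add: jtheta_def mult_ac)
  qed
  have "range h1 \<inter> range h2 = {}"
    unfolding h1_def h2_def by (auto, presburger)
  moreover have "range h1 \<union> range h2 = UNIV"
  proof -
    have "(m, n) \<in> range h1 \<union> range h2" for m n
    proof (cases "even (m + n)")
      case True
      then have "(m, n) = h1 ((m + n) div 2, (m - n) div 2)"
        unfolding h1_def prod.case prod.inject by presburger
      then show ?thesis by blast
    next
      case False
      then have "(m, n) = h2 ((m + n) div 2, (m - n) div 2)"
        unfolding h2_def prod.case prod.inject by presburger
      then show ?thesis by blast
    qed
    then show ?thesis by auto
  qed
  ultimately have "(F has_sum jtheta (p\<^sup>2) (a\<^sup>2) * jtheta (p\<^sup>2) (b\<^sup>2) +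
    p * (a * jtheta (p\<^sup>2) ((p * a)\<^sup>2)) * (b * jtheta (p\<^sup>2) ((p * b)\<^sup>2))) UNIV"
    using has_sum_Un_disjoint[OF 1 2] by simp
  with F show ?thesis
    by (rule has_sum_unique)
qed

text \<open>Quasi-periodicity, from the index shift \<open>l\<close> to \<open>l + 1\<close> and
  \<open>(l + 1)^2 = l^2 + 2l + 1\<close>.\<close>

lemma jtheta_shift:
  assumes p: "norm p < 1" "p \<noteq> 0" and w: "w \<noteq> 0"
  shows "jtheta p w = p * w * jtheta p (p\<^sup>2 * w)"
proof -
  have "((\<lambda>l::int. p * w * (p powi (l * l) * (p\<^sup>2 * w) powi l)) has_sum p * w * jtheta p (p\<^sup>2 * w)) UNIV"
    using assms by (intro has_sum_cmult_right jtheta_has_sum) auto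
  moreover have "p * w * (p powi (l * l) * (p\<^sup>2 * w) powi l) = p powi ((l + 1) * (l + 1)) * w powi (l + 1)" for l
  proof -
    have "(p\<^sup>2) powi l = p powi (2 * l)"
      by (simp add: power_int_mult)
    moreover have "(l + 1) * (l + 1) = l * l + 2 * l + 1"
      by (simp add: algebra_simps)
    ultimately show ?thesis
      using p w by (simp add: power_int_add power_int_mult_distrib)
  qed
  ultimately have "((\<lambda>l::int. p powi ((l + 1) * (l + 1)) * w powi (l + 1)) has_sum p * w * jtheta p (p\<^sup>2 * w)) UNIV"
    by simp
  moreover have "bij_betw (\<lambda>l::int. l + 1) UNIV UNIV"
    by (rule bij_betw_byWitness[where f' = "\<lambda>l. l - 1"]) auto
  ultimately have "((\<lambda>l::int. p powi (l * l) * w powi l) has_sum p * w * jtheta p (p\<^sup>2 * w)) UNIV"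
    using has_sum_reindex_bij_betw[of "\<lambda>l::int. l + 1" UNIV UNIV "\<lambda>l. p powi (l * l) * w powi l"] by simp
  then show ?thesis
    using jtheta_has_sum[OF assms] has_sum_unique by blast
qed

subsection \<open>The Jacobi triple product\<close>

lemma prod_lessThan_add:
  fixes f :: "nat \<Rightarrow> 'a :: comm_monoid_mult"
  shows "(\<Prod>i<m + n. f i) = (\<Prod>i<m. f i) * (\<Prod>i<n. f (m + i))"
  by (induction n) (simp_all add: mult.assoc)

section \<open>Gaussian binomials and the finite triple product\<close>

definition euler_prod :: "complex \<Rightarrow> nat \<Rightarrow> complex" where
  "euler_prod q n = (\<Prod>i<n. 1 - q ^ Suc i)"

lemma euler_prod_0 [simp]: "euler_prod q 0 = 1"
  by (simp add: euler_prod_def)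

lemma euler_prod_Suc: "euler_prod q (Suc n) = euler_prod q n * (1 - q ^ Suc n)"
  by (simp add: euler_prod_def)

lemma one_minus_mult_power_nonzero:
  fixes a q :: complex
  assumes "norm q < 1" "norm a < 1"
  shows "1 - a * q ^ i \<noteq> 0"
proof -
  have "norm (a * q ^ i) \<le> norm a * 1"
    unfolding norm_mult norm_power using assms by (intro mult_left_mono power_le_one) auto
  then show ?thesis
    using assms by auto
qed

lemma euler_prod_nonzero:
  assumes "norm q < 1"
  shows "euler_prod q n \<noteq> 0"
  using one_minus_mult_power_nonzero[OF assms assms] by (auto simp: euler_prod_def)

lemma qpoch_inf_nonzero:
  assumes "norm q < 1" "norm a < 1"
  shows "qpoch_inf a q \<noteq> 0"
  unfolding qpoch_inf_def using assms
  by (intro prodinf_nonzero convergent_prod_qpoch_inf one_minus_mult_power_nonzero)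

lemma qpoch_inf_LIMSEQ:
  assumes "norm q < 1"
  shows "(\<lambda>n. \<Prod>i<n. 1 - a * q ^ i) \<longlonglongrightarrow> qpoch_inf a q"
proof -
  have "(\<lambda>n. \<Prod>i<Suc n. 1 - a * q ^ i) \<longlonglongrightarrow> qpoch_inf a q"
    using convergent_prod_LIMSEQ[OF convergent_prod_qpoch_inf[OF assms]]
    unfolding qpoch_inf_def lessThan_Suc_atMost .
  then show ?thesis
    by (rule LIMSEQ_imp_Suc)
qed

lemma euler_prod_LIMSEQ:
  assumes "norm q < 1"
  shows "euler_prod q \<longlonglongrightarrow> qpoch_inf q q"
  using qpoch_inf_LIMSEQ[OF assms, of q] by (simp add: euler_prod_def[abs_def])

text \<open>The quotient form makes both the uniform bound and the limit of the central coefficients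
  direct consequences of the convergence of \<open>euler_prod\<close>.\<close>

definition gauss_binom :: "complex \<Rightarrow> nat \<Rightarrow> nat \<Rightarrow> complex" where
  "gauss_binom q m j =
    (if j \<le> m then euler_prod q m / (euler_prod q j * euler_prod q (m - j)) else 0)"

text \<open>The q-Pascal rule. With \<open>m = j + k + 1\<close> and common factors removed it is
  \<open>1 - q^(m+1) = (1 - q^(k+1)) + q^(k+1) * (1 - q^(j+1))\<close>.\<close>

lemma gauss_binom_Suc_Suc:
  assumes q: "norm q < 1" and j: "j \<le> m"
  shows "gauss_binom q (Suc m) (Suc j) = gauss_binom q m (Suc j) + q ^ (m - j) * gauss_binom q m j"
\<comment> \<open>For \<open>j = m\<close> the coefficient \<open>gauss_binom q m (Suc j)\<close> is
  the default 0 and not a quotient.\<close>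
proof (cases "j = m")
  case True
  then show ?thesis
    using euler_prod_nonzero[OF q] by (simp add: gauss_binom_def)
next
  case False
  then obtain k where k: "m = Suc (j + k)"
    using j less_imp_Suc_add le_neq_implies_less by metis
  define A B C where "A = euler_prod q j" and "B = euler_prod q k" and "C = euler_prod q m"
  have nz: "A \<noteq> 0" "B \<noteq> 0" "1 - q ^ Suc j \<noteq> 0" "1 - q ^ Suc k \<noteq> 0"
    using euler_prod_nonzero[OF q] one_minus_mult_power_nonzero[OF q q] by (simp_all add: A_def B_def)
  have le: "Suc j \<le> Suc m" "Suc j \<le> m" "j \<le> m"
    and diff: "Suc m - Suc j = Suc k" "m - Suc j = k" "m - j = Suc k"
    using k by auto
  have "gauss_binom q (Suc m) (Suc j) = C * (1 - q ^ Suc m) / (A * (1 - q ^ Suc j) * (B * (1 - q ^ Suc k)))"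
    by (simp only: gauss_binom_def le if_True diff euler_prod_Suc A_def B_def C_def)
  moreover have "gauss_binom q m (Suc j) = C / (A * (1 - q ^ Suc j) * B)"
    by (simp only: gauss_binom_def le if_True diff euler_prod_Suc A_def B_def C_def)
  moreover have "gauss_binom q m j = C / (A * (B * (1 - q ^ Suc k)))"
    by (simp only: gauss_binom_def le if_True diff euler_prod_Suc A_def B_def C_def)
  moreover have "1 - q ^ Suc m = (1 - q ^ Suc k) + q ^ Suc k * (1 - q ^ Suc j)"
    by (simp add: k algebra_simps power_add)
  ultimately show ?thesis
    unfolding diff using nz by (simp only:) (simp add: divide_simps, simp add: algebra_simps)
qed

lemma gauss_binom_0_right [simp]: "norm q < 1 \<Longrightarrow> gauss_binom q m 0 = 1"
  using euler_prod_nonzero by (simp add: gauss_binom_def)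

lemma gauss_binom_eq_0 [simp]: "m < j \<Longrightarrow> gauss_binom q m j = 0"
  by (simp add: gauss_binom_def)

text \<open>Induction on the number of factors: multiplying by the new factor is the q-Pascal rule
  applied coefficientwise, because \<open>2m + 1 + j^2 = 2(m - j) + (j + 1)^2\<close>.\<close>

lemma q_binomial_theorem:
  fixes p w :: complex
  assumes p: "norm p < 1"
  shows "(\<Prod>i<m. 1 + w * p ^ (2 * i + 1)) = (\<Sum>j\<le>m. gauss_binom (p\<^sup>2) m j * p ^ (j * j) * w ^ j)"
proof (induction m)
  case 0
  then show ?case by (simp add: gauss_binom_def)
next
  case (Suc m)
  have p2: "norm (p\<^sup>2) < 1"
    using p by (simp add: norm_power power_less_one_iff)
  define t where "t = (\<lambda>m j. gauss_binom (p\<^sup>2) m j * p ^ (j * j) * w ^ j)"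
  have step: "t (Suc m) (Suc j) = t m (Suc j) + w * p ^ (2 * m + 1) * t m j" if "j \<le> m" for j
  proof -
    have "p ^ (2 * m + 1) * p ^ (j * j) = (p\<^sup>2) ^ (m - j) * p ^ (Suc j * Suc j)"
      unfolding power_mult[symmetric] power_add[symmetric] using that
      by (intro arg_cong[of _ _ "power p"]) (auto simp: algebra_simps dest!: le_Suc_ex)
    then show ?thesis
      unfolding t_def gauss_binom_Suc_Suc[OF p2 that] by (simp add: algebra_simps del: mult_Suc mult_Suc_right)
  qed
  have "(\<Sum>j\<le>Suc m. t (Suc m) j) = t (Suc m) 0 + (\<Sum>j\<le>m. t (Suc m) (Suc j))"
    by (rule sum.atMost_Suc_shift)
  also have "\<dots> = t m 0 + (\<Sum>j\<le>m. t m (Suc j)) + w * p ^ (2 * m + 1) * (\<Sum>j\<le>m. t m j)"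
    using p2 by (simp add: step sum.distrib sum_distrib_left) (simp add: t_def)
  also have "t m 0 + (\<Sum>j\<le>m. t m (Suc j)) = (\<Sum>j\<le>Suc m. t m j)"
    by (rule sum.atMost_Suc_shift[symmetric])
  \<comment> \<open>The term at \<open>Suc m\<close> vanishes since \<open>gauss_binom\<close> is 0
    above the diagonal.\<close>
  also have "\<dots> = (\<Sum>j\<le>m. t m j)"
    by (simp add: t_def)
  finally show ?case
    using Suc unfolding t_def by (simp add: algebra_simps)
qed

text \<open>The q-binomial theorem with \<open>2 * n\<close> factors, recentred: the upper
  \<open>n\<close> factors contain \<open>w\<close>, the lower \<open>n\<close>, read backwards,
  contain \<open>1 / w\<close>, and the summation index is shifted by \<open>n\<close>.\<close>

lemma finite_jacobi_triple_product:
  fixes p w :: complex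
  assumes p: "norm p < 1" "p \<noteq> 0" and w: "w \<noteq> 0"
  shows "(\<Prod>k<n. (1 + w * p ^ (2 * k + 1)) * (1 + p ^ (2 * k + 1) / w)) =
    (\<Sum>j\<le>2 * n. gauss_binom (p\<^sup>2) (2 * n) j * (p powi ((int j - int n) * (int j - int n)) * w powi (int j - int n)))"
proof -
  \<comment> \<open>Chosen so that factor \<open>n + k\<close> is \<open>1 + w * p^(2k+1)\<close>,
    while factor \<open>n - 1 - k\<close> is \<open>1 + w / p^(2k+1)\<close>.\<close>
  define v where "v = w / p ^ (2 * n)"
  have low: "(\<Prod>i<n. 1 + v * p ^ (2 * i + 1)) = w ^ n / p ^ (n * n) * (\<Prod>k<n. 1 + p ^ (2 * k + 1) / w)"
  proof -
    have "(\<Prod>i<n. 1 + v * p ^ (2 * i + 1)) = (\<Prod>k<n. 1 + v * p ^ (2 * (n - Suc k) + 1))"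
      by (rule prod.nat_diff_reindex[symmetric])
    also have "\<dots> = (\<Prod>k<n. w / p ^ (2 * k + 1) * (1 + p ^ (2 * k + 1) / w))"
    proof (rule prod.cong)
      fix k assume "k \<in> {..<n}"
      then have "2 * (n - Suc k) + 1 + (2 * k + 1) = 2 * n"
        by auto
      then have "p ^ (2 * n) = p ^ (2 * (n - Suc k) + 1) * p ^ (2 * k + 1)"
        by (metis power_add)
      then show "1 + v * p ^ (2 * (n - Suc k) + 1) = w / p ^ (2 * k + 1) * (1 + p ^ (2 * k + 1) / w)"
        unfolding v_def using p w by (simp only:) (simp add: field_simps)
    qed simp
    also have "\<dots> = (\<Prod>k<n. w / p ^ (2 * k + 1)) * (\<Prod>k<n. 1 + p ^ (2 * k + 1) / w)"
      by (rule prod.distrib)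
    \<comment> \<open>The first \<open>n\<close> odd numbers sum to \<open>n^2\<close>.\<close>
    also have "(\<Prod>k<n. w / p ^ (2 * k + 1)) = w ^ n / p ^ (n * n)"
      using p by (induction n) (simp_all add: field_simps power_add power_mult power2_eq_square)
    finally show ?thesis .
  qed
  have "(\<Prod>i<2 * n. 1 + v * p ^ (2 * i + 1)) =
      (\<Prod>i<n. 1 + v * p ^ (2 * i + 1)) * (\<Prod>k<n. 1 + v * p ^ (2 * (n + k) + 1))"
    unfolding mult_2[of n] by (rule prod_lessThan_add)
  also have "(\<Prod>k<n. 1 + v * p ^ (2 * (n + k) + 1)) = (\<Prod>k<n. 1 + w * p ^ (2 * k + 1))"
    using p by (intro prod.cong) (auto simp: v_def power_add algebra_simps)
  finally have "(\<Prod>k<n. (1 + w * p ^ (2 * k + 1)) * (1 + p ^ (2 * k + 1) / w)) =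
      p ^ (n * n) / w ^ n * (\<Prod>i<2 * n. 1 + v * p ^ (2 * i + 1))"
    unfolding low prod.distrib using p w by simp
  also have "\<dots> = (\<Sum>j\<le>2 * n. p ^ (n * n) / w ^ n * (gauss_binom (p\<^sup>2) (2 * n) j * p ^ (j * j) * v ^ j))"
    unfolding q_binomial_theorem[OF p(1)] by (rule sum_distrib_left)
  also have "\<dots> = (\<Sum>j\<le>2 * n. gauss_binom (p\<^sup>2) (2 * n) j * (p powi ((int j - int n) * (int j - int n)) * w powi (int j - int n)))"
  proof (rule sum.cong)
    fix j
    have e: "(int j - int n) * (int j - int n) = int (n * n) + int (j * j) - int (2 * n * j)"
      by (simp add: algebra_simps)
    have "p powi ((int j - int n) * (int j - int n)) = p ^ (n * n) * p ^ (j * j) / p ^ (2 * n * j)"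
      unfolding e using p by (simp only: power_int_diff power_int_add power_int_of_nat simp_thms)
    moreover have "w powi (int j - int n) = w ^ j / w ^ n"
      using w by (simp add: power_int_diff)
    moreover have "v ^ j = w ^ j / p ^ (2 * n * j)"
      by (simp add: v_def power_divide power_mult)
    ultimately show "p ^ (n * n) / w ^ n * (gauss_binom (p\<^sup>2) (2 * n) j * p ^ (j * j) * v ^ j) =
        gauss_binom (p\<^sup>2) (2 * n) j * (p powi ((int j - int n) * (int j - int n)) * w powi (int j - int n))"
      by (simp add: mult_ac)
  qed simp
  finally show ?thesis .
qed

text \<open>\<open>euler_prod\<close> converges to a nonzero limit, so it and its inverse are
  bounded. The bound, uniform in \<open>m\<close> and \<open>j\<close>, provides the dominating
  family for \<open>tannery_int\<close>.\<close>

lemma gauss_binom_bounded: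
  assumes q: "norm q < 1"
  obtains K where "\<And>m j. norm (gauss_binom q m j) \<le> K"
proof -
  have "Bseq (euler_prod q)" "Bseq (\<lambda>n. inverse (euler_prod q n))"
    using euler_prod_LIMSEQ[OF q] qpoch_inf_nonzero[OF q q]
    by (auto intro!: convergent_imp_Bseq convergentI tendsto_inverse)
  then obtain A B where AB: "A > 0" "\<And>n. norm (euler_prod q n) \<le> A"
      "B > 0" "\<And>n. norm (inverse (euler_prod q n)) \<le> B"
    unfolding Bseq_def by blast
  have "norm (gauss_binom q m j) \<le> A * (B * B)" for m j
  proof (cases "j \<le> m")
    case True
    then have "gauss_binom q m j = euler_prod q m * (inverse (euler_prod q j) * inverse (euler_prod q (m - j)))"
      by (simp add: gauss_binom_def divide_inverse)
    then show ?thesis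
      unfolding norm_mult using AB by (auto simp: norm_mult intro!: mult_mono)
  qed (use AB in auto)
  then show ?thesis
    using that by blast
qed

theorem jacobi_triple_product:
  fixes p w :: complex
  assumes p: "norm p < 1" "p \<noteq> 0" and w: "w \<noteq> 0"
  shows "jtheta p w = qpoch_inf (p\<^sup>2) (p\<^sup>2) * qpoch_inf (- (w * p)) (p\<^sup>2) * qpoch_inf (- (p / w)) (p\<^sup>2)"
proof -
  have p2: "norm (p\<^sup>2) < 1"
    using p by (simp add: norm_power power_less_one_iff)
  define E where "E = qpoch_inf (p\<^sup>2) (p\<^sup>2)"
  have E: "E \<noteq> 0"
    unfolding E_def using p2 by (intro qpoch_inf_nonzero)
  \<comment> \<open>The finite identity as a sum over all integers. The guard is needed because
    \<open>nat\<close> would send \<open>n + l < 0\<close> to index 0; for \<open>l > n\<close> the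
    value 0 comes from \<open>gauss_binom\<close>.\<close>
  define c where "c = (\<lambda>n l. if - int n \<le> l then gauss_binom (p\<^sup>2) (2 * n) (nat (int n + l)) else 0)"
  define t where "t = (\<lambda>l. p powi (l * l) * w powi l)"
  obtain K where K: "\<And>m j. norm (gauss_binom (p\<^sup>2) m j) \<le> K"
    using gauss_binom_bounded[OF p2] by blast
  have "0 \<le> K"
    using K[of 0 0] norm_ge_zero order_trans by blast
  have sum: "(\<Sum>\<^sub>\<infinity>l. c n l * t l) = (\<Prod>k<n. 1 - (- (w * p)) * (p\<^sup>2) ^ k) * (\<Prod>k<n. 1 - (- (p / w)) * (p\<^sup>2) ^ k)" for n
  proof -
    have "(\<Sum>\<^sub>\<infinity>l. c n l * t l) = (\<Sum>\<^sub>\<infinity>l\<in>(\<lambda>j. int j - int n) ` {..2 * n}. c n l * t l)"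
    proof (rule infsum_cong_neutral)
      fix l assume "l \<in> UNIV - (\<lambda>j. int j - int n) ` {..2 * n}"
      then have *: "l \<noteq> int j - int n" if "j \<le> 2 * n" for j
        using that by auto
      have "\<not> - int n \<le> l \<or> 2 * n < nat (int n + l)"
        using *[of "nat (int n + l)"] by linarith
      then show "c n l * t l = 0"
        by (auto simp: c_def)
    qed auto
    also have "\<dots> = (\<Sum>l\<in>(\<lambda>j. int j - int n) ` {..2 * n}. c n l * t l)"
      by (rule infsum_finite) simp
    also have "\<dots> = (\<Sum>j\<le>2 * n. gauss_binom (p\<^sup>2) (2 * n) j * t (int j - int n))"
      by (subst sum.reindex) (auto simp: inj_on_def c_def)
    also have "\<dots> = (\<Prod>k<n. (1 + w * p ^ (2 * k + 1)) * (1 + p ^ (2 * k + 1) / w))"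
      unfolding t_def by (rule finite_jacobi_triple_product[OF assms, symmetric])
    also have "\<dots> = (\<Prod>k<n. 1 - (- (w * p)) * (p\<^sup>2) ^ k) * (\<Prod>k<n. 1 - (- (p / w)) * (p\<^sup>2) ^ k)"
      unfolding prod.distrib by (simp add: power_mult) (simp add: mult_ac)
    finally show ?thesis .
  qed
  have "(\<lambda>n. \<Sum>\<^sub>\<infinity>l. c n l * t l) \<longlonglongrightarrow> (\<Sum>\<^sub>\<infinity>l. inverse E * t l)"
  proof (rule tannery_int)
    show "norm (c n l * t l) \<le> K * norm (t l)" for n l
      unfolding norm_mult using K \<open>0 \<le> K\<close> by (intro mult_right_mono) (auto simp: c_def)
    show "(\<lambda>l. K * norm (t l)) summable_on UNIV"
      unfolding t_def using jtheta_abs_summable[OF assms] by (rule summable_on_cmult_right)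
    show "(\<lambda>n. c n l * t l) \<longlonglongrightarrow> inverse E * t l" for l
    proof (intro tendsto_mult tendsto_const)
      have lim: "(\<lambda>n. euler_prod (p\<^sup>2) (f n)) \<longlonglongrightarrow> E" if "filterlim f at_top sequentially" for f
        using euler_prod_LIMSEQ[OF p2] that unfolding E_def by (rule filterlim_compose)
      have double: "filterlim (\<lambda>n::nat. 2 * n) at_top sequentially"
        by (rule filterlim_at_top_mono[OF filterlim_ident]) auto
      have plus: "filterlim (\<lambda>n. nat (int n + k)) at_top sequentially" for k
        unfolding filterlim_at_top
      proof
        show "eventually (\<lambda>n. Z \<le> nat (int n + k)) sequentially" for Z
          by (rule eventually_sequentiallyI[of "nat (int Z - k)"]) auto
      qed
      have minus: "filterlim (\<lambda>n. nat (int n - l)) at_top sequentially"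
        using plus[of "- l"] by simp
      \<comment> \<open>For fixed \<open>l\<close> all three indices tend to infinity, so the
        coefficient tends to \<open>E / (E * E)\<close>.\<close>
      have "(\<lambda>n. euler_prod (p\<^sup>2) (2 * n) /
          (euler_prod (p\<^sup>2) (nat (int n + l)) * euler_prod (p\<^sup>2) (nat (int n - l)))) \<longlonglongrightarrow> E / (E * E)"
        using E by (intro tendsto_divide tendsto_mult lim double plus minus) auto
      moreover have "eventually (\<lambda>n. euler_prod (p\<^sup>2) (2 * n) /
          (euler_prod (p\<^sup>2) (nat (int n + l)) * euler_prod (p\<^sup>2) (nat (int n - l))) = c n l) sequentially"
        using eventually_ge_at_top[of "nat \<bar>l\<bar>"]
      proof eventually_elim
        case (elim n)
        then have "2 * n - nat (int n + l) = nat (int n - l)" "nat (int n + l) \<le> 2 * n" "- int n \<le> l"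
          by auto
        then show ?case
          by (simp add: c_def gauss_binom_def)
      qed
      ultimately have "(\<lambda>n. c n l) \<longlonglongrightarrow> E / (E * E)"
        by (rule Lim_transform_eventually)
      then show "(\<lambda>n. c n l) \<longlonglongrightarrow> inverse E"
        using E by (simp add: field_simps)
    qed
  qed
  then have "(\<lambda>n. \<Sum>\<^sub>\<infinity>l. c n l * t l) \<longlonglongrightarrow> inverse E * jtheta p w"
    unfolding jtheta_def t_def infsum_cmult_right' .
  moreover have "(\<lambda>n. \<Sum>\<^sub>\<infinity>l. c n l * t l) \<longlonglongrightarrow> qpoch_inf (- (w * p)) (p\<^sup>2) * qpoch_inf (- (p / w)) (p\<^sup>2)"
    unfolding sum by (intro tendsto_mult qpoch_inf_LIMSEQ p2)
  ultimately have "inverse E * jtheta p w = qpoch_inf (- (w * p)) (p\<^sup>2) * qpoch_inf (- (p / w)) (p\<^sup>2)"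
    by (rule LIMSEQ_unique)
  then show ?thesis
    using E by (simp add: E_def field_simps)
qed

subsection \<open>Consequences of the triple product\<close>

text \<open>Factors are grouped by the residue of their index modulo \<open>k\<close>. This is exact
  for \<open>k * n\<close> factors, and the limit is taken along that subsequence.\<close>

lemma qpoch_inf_dissect:
  fixes a q :: complex
  assumes q: "norm q < 1" and k: "k > 0"
  shows "qpoch_inf a q = (\<Prod>i<k. qpoch_inf (a * q ^ i) (q ^ k))"
proof -
  have qk: "norm (q ^ k) < 1"
    using q k by (simp add: norm_power power_less_one_iff)
  have eq: "(\<Prod>i<k * n. 1 - a * q ^ i) = (\<Prod>i<k. \<Prod>j<n. 1 - (a * q ^ i) * (q ^ k) ^ j)" for n
  proof -
    have "(\<Prod>i<k * n. 1 - a * q ^ i) = (\<Prod>j<n. \<Prod>i<k. 1 - a * q ^ (k * j + i))"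
    proof (induction n)
      case (Suc n)
      then show ?case
        using prod_lessThan_add[of "\<lambda>i. 1 - a * q ^ i" "k * n" k] by (simp add: add.commute)
    qed simp
    also have "\<dots> = (\<Prod>j<n. \<Prod>i<k. 1 - (a * q ^ i) * (q ^ k) ^ j)"
      by (simp add: power_add power_mult) (simp add: mult_ac)
    also have "\<dots> = (\<Prod>i<k. \<Prod>j<n. 1 - (a * q ^ i) * (q ^ k) ^ j)"
      by (rule prod.swap)
    finally show ?thesis .
  qed
  have "filterlim (\<lambda>n. k * n) at_top sequentially"
    using k by (intro filterlim_subseq strict_monoI) simp
  with qpoch_inf_LIMSEQ[OF q, of a] have "(\<lambda>n. \<Prod>i<k * n. 1 - a * q ^ i) \<longlonglongrightarrow> qpoch_inf a q"
    by (rule filterlim_compose)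
  moreover have "(\<lambda>n. \<Prod>i<k. \<Prod>j<n. 1 - (a * q ^ i) * (q ^ k) ^ j) \<longlonglongrightarrow> (\<Prod>i<k. qpoch_inf (a * q ^ i) (q ^ k))"
    by (intro tendsto_prod qpoch_inf_LIMSEQ qk)
  ultimately show ?thesis
    unfolding eq by (rule LIMSEQ_unique)
qed

lemma qpoch_inf_mult_minus:
  assumes q: "norm q < 1"
  shows "qpoch_inf a q * qpoch_inf (- a) q = qpoch_inf (a\<^sup>2) (q\<^sup>2)"
proof -
  have q2: "norm (q\<^sup>2) < 1"
    using q by (simp add: norm_power power_less_one_iff)
  have "(\<lambda>n. (\<Prod>i<n. 1 - a * q ^ i) * (\<Prod>i<n. 1 - (- a) * q ^ i)) \<longlonglongrightarrow> qpoch_inf a q * qpoch_inf (- a) q"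
    by (intro tendsto_mult qpoch_inf_LIMSEQ q)
  moreover have "(\<Prod>i<n. 1 - a * q ^ i) * (\<Prod>i<n. 1 - (- a) * q ^ i) = (\<Prod>i<n. 1 - a\<^sup>2 * (q\<^sup>2) ^ i)" for n
    unfolding prod.distrib[symmetric]
    by (intro prod.cong) (simp_all add: algebra_simps power2_eq_square power_mult_distrib)
  ultimately have "(\<lambda>n. \<Prod>i<n. 1 - a\<^sup>2 * (q\<^sup>2) ^ i) \<longlonglongrightarrow> qpoch_inf a q * qpoch_inf (- a) q"
    by simp
  then show ?thesis
    using qpoch_inf_LIMSEQ[OF q2] by (rule LIMSEQ_unique)
qed

lemma qpoch_inf_head:
  assumes q: "norm q < 1"
  shows "qpoch_inf a q = (1 - a) * qpoch_inf (a * q) q"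
proof -
  have "(\<lambda>n. \<Prod>i<Suc n. 1 - a * q ^ i) \<longlonglongrightarrow> qpoch_inf a q"
    using qpoch_inf_LIMSEQ[OF q] by (rule LIMSEQ_Suc)
  moreover have "(\<lambda>n. \<Prod>i<Suc n. 1 - a * q ^ i) \<longlonglongrightarrow> (1 - a) * qpoch_inf (a * q) q"
    unfolding prod.lessThan_Suc_shift using tendsto_mult_left[OF qpoch_inf_LIMSEQ[OF q, of "a * q"], of "1 - a"]
    by (simp add: mult.assoc)
  ultimately show ?thesis
    by (rule LIMSEQ_unique)
qed

text \<open>Since \<open>n(n + 1)\<close> is invariant under \<open>n\<close> to
  \<open>- 1 - n\<close>, the bilateral series \<open>jtheta t t\<close> is twice the sum, and the
  triple product evaluates it.\<close>

theorem gauss_triangular_sums: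
  fixes t :: complex
  assumes t: "norm t < 1" "t \<noteq> 0"
  shows "(\<lambda>n. t ^ (n * (n + 1))) sums ((qpoch_inf (t ^ 4) (t ^ 4))\<^sup>2 / qpoch_inf (t\<^sup>2) (t\<^sup>2))"
proof -
  have t2: "norm (t\<^sup>2) < 1"
    using t by (simp add: norm_power power_less_one_iff)
  define f where "f = (\<lambda>l::int. t powi (l * l) * t powi l)"
  have f: "(f has_sum jtheta t t) UNIV"
    unfolding f_def using t by (intro jtheta_has_sum) auto
  have f_nat: "f (int n) = t ^ (n * (n + 1))" for n
    by (simp add: f_def power_add power_int_def nat_mult_distrib)
  have f_neg: "f (- 1 - int n) = t ^ (n * (n + 1))" for n
  proof -
    have "f (- 1 - int n) = t powi ((- 1 - int n) * (- 1 - int n) + (- 1 - int n))"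
      using t by (simp add: f_def power_int_add)
    also have "(- 1 - int n) * (- 1 - int n) + (- 1 - int n) = int (n * (n + 1))"
      by (simp add: algebra_simps)
    finally show ?thesis
      by (simp only: power_int_of_nat)
  qed
  have "f summable_on range int"
    by (rule summable_on_subset_banach[OF has_sum_imp_summable[OF f]]) simp
  then have "(\<lambda>n. f (int n)) summable_on UNIV"
    by (subst (asm) summable_on_reindex) (auto simp: o_def)
  then obtain S where S: "((\<lambda>n. t ^ (n * (n + 1))) has_sum S) UNIV"
    unfolding f_nat summable_on_def by blast
  then have "(f has_sum (S + S)) UNIV"
    by (intro has_sum_int_split) (simp_all only: f_nat f_neg)
  then have "S + S = jtheta t t"
    using f by (rule has_sum_unique)
  then have "2 * S = jtheta t t"
    by simp
  also have "\<dots> = qpoch_inf (t\<^sup>2) (t\<^sup>2) * qpoch_inf (- (t\<^sup>2)) (t\<^sup>2) * qpoch_inf (- 1) (t\<^sup>2)"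
    using t jacobi_triple_product[of t t] by (simp add: power2_eq_square)
  \<comment> \<open>The leading factor \<open>1 - (- 1) = 2\<close> cancels the doubling.\<close>
  also have "qpoch_inf (- 1) (t\<^sup>2) = 2 * qpoch_inf (- (t\<^sup>2)) (t\<^sup>2)"
    using qpoch_inf_head[OF t2, of "- 1"] by simp
  finally have "S = qpoch_inf (t\<^sup>2) (t\<^sup>2) * (qpoch_inf (- (t\<^sup>2)) (t\<^sup>2))\<^sup>2"
    by (simp add: power2_eq_square)
  moreover have "qpoch_inf (t\<^sup>2) (t\<^sup>2) * qpoch_inf (- (t\<^sup>2)) (t\<^sup>2) = qpoch_inf (t ^ 4) (t ^ 4)"
    using qpoch_inf_mult_minus[OF t2, of "t\<^sup>2"] by simp
  moreover have "qpoch_inf (t\<^sup>2) (t\<^sup>2) \<noteq> 0"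
    by (rule qpoch_inf_nonzero[OF t2 t2])
  ultimately have "S = (qpoch_inf (t ^ 4) (t ^ 4))\<^sup>2 / qpoch_inf (t\<^sup>2) (t\<^sup>2)"
    by (simp add: field_simps power2_eq_square flip: \<open>qpoch_inf (t\<^sup>2) (t\<^sup>2) * qpoch_inf (- (t\<^sup>2)) (t\<^sup>2) = qpoch_inf (t ^ 4) (t ^ 4)\<close>)
  then show ?thesis
    using has_sum_imp_sums[OF S] by simp
qed

section \<open>The three-term relation for theta functions\<close>

text \<open>Up to the factor \<open>x\<close>, the right-hand side is a \<open>2 \<times> 2\<close> minor, so the three-term relation is the
  Pluecker relation between minors.\<close>

lemma jtheta_mult_eq_minor:
  fixes p x y :: complex
  assumes p: "norm p < 1" "p \<noteq> 0" and x: "x \<noteq> 0" and y: "y \<noteq> 0"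
  defines "f \<equiv> \<lambda>z. jtheta (p\<^sup>2) (z\<^sup>2)" and "g \<equiv> \<lambda>z. z * jtheta (p\<^sup>2) ((p * z)\<^sup>2)"
  shows "jtheta p (- (x * y / p)) * jtheta p (- (x / y / p)) = x * (g x * f y - f x * g y)"
proof -
  have p2: "norm (p\<^sup>2) < 1" "p\<^sup>2 \<noteq> 0"
    using p by (auto simp: norm_power power_less_one_iff)
  \<comment> \<open>Quasi-periodicity gives \<open>f (x / p) = x * g x\<close>. Applying
    \<open>jtheta_mult\<close> to \<open>x / p\<close> and \<open>- y\<close> then produces the
    minor; the sign of \<open>- y\<close> supplies its minus.\<close>
  have "jtheta (p\<^sup>2) ((x / p)\<^sup>2) = x\<^sup>2 * jtheta (p\<^sup>2) ((p * x)\<^sup>2)"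
  proof -
    have "(p\<^sup>2)\<^sup>2 * (x / p)\<^sup>2 = (p * x)\<^sup>2" "p\<^sup>2 * (x / p)\<^sup>2 = x\<^sup>2"
      using p by (simp_all add: field_simps power2_eq_square)
    then show ?thesis
      using jtheta_shift[OF p2, of "(x / p)\<^sup>2"] x p by simp
  qed
  moreover have "- (x * y / p) = (x / p) * (- y)" "- (x / y / p) = (x / p) / (- y)"
    by (simp_all add: field_simps)
  ultimately show ?thesis
    using jtheta_mult[OF p, of "x / p" "- y"] x y p
    by (simp add: f_def g_def algebra_simps power2_eq_square)
qed

text \<open>By the triple product, \<open>T z\<close> is \<open>(p^2, z, p^2/z; p^2)\<close>, the
  theta function vanishing at \<open>z = 1\<close>. After the minors are inserted, the weights
  \<open>y\<close> and \<open>u\<close> give every term the common factor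
  \<open>x * y * u\<close>.\<close>

theorem weierstrass_three_term:
  fixes p x y u v :: complex
  assumes "norm p < 1" "p \<noteq> 0" "x \<noteq> 0" "y \<noteq> 0" "u \<noteq> 0" "v \<noteq> 0"
  defines "T \<equiv> \<lambda>z. jtheta p (- (z / p))"
  shows "y * (T (x * y) * T (x / y) * T (u * v) * T (u / v) - T (x * v) * T (x / v) * T (u * y) * T (u / y)) =
    u * (T (y * v) * T (y / v) * T (x * u) * T (x / u))"
proof -
  define f where "f = (\<lambda>z. jtheta (p\<^sup>2) (z\<^sup>2))"
  define g where "g = (\<lambda>z. z * jtheta (p\<^sup>2) ((p * z)\<^sup>2))"
  have T: "T (a * b) * T (a / b) = a * (g a * f b - f a * g b)" if "a \<noteq> 0" "b \<noteq> 0" for a b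
    unfolding T_def f_def g_def using assms that by (intro jtheta_mult_eq_minor)
  have "y * ((T (x * y) * T (x / y)) * (T (u * v) * T (u / v)) - (T (x * v) * T (x / v)) * (T (u * y) * T (u / y))) =
    u * ((T (y * v) * T (y / v)) * (T (x * u) * T (x / u)))"
    unfolding T[OF \<open>x \<noteq> 0\<close> \<open>y \<noteq> 0\<close>] T[OF \<open>u \<noteq> 0\<close> \<open>v \<noteq> 0\<close>] T[OF \<open>x \<noteq> 0\<close> \<open>v \<noteq> 0\<close>]
      T[OF \<open>u \<noteq> 0\<close> \<open>y \<noteq> 0\<close>] T[OF \<open>y \<noteq> 0\<close> \<open>v \<noteq> 0\<close>] T[OF \<open>x \<noteq> 0\<close> \<open>u \<noteq> 0\<close>]
    by (simp add: algebra_simps)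
  then show ?thesis
    by (simp add: mult.assoc)
qed

text \<open>This is \<open>T (q ^ k)\<close> of the three-term relation for
  \<open>p = q ^ m\<close>. With \<open>m = 10\<close> it equals \<open>[k]\<close> times
  \<open>(q^20; q^20)\<close>.\<close>

lemma jtheta_power_eq:
  fixes q :: complex
  assumes q: "norm q < 1" "q \<noteq> 0" and m: "m > 0" and k: "k \<le> 2 * m"
  shows "jtheta (q ^ m) (- (q ^ k / q ^ m)) =
    qpoch_inf (q ^ (2 * m)) (q ^ (2 * m)) * qpoch_inf (q ^ k) (q ^ (2 * m)) * qpoch_inf (q ^ (2 * m - k)) (q ^ (2 * m))"
proof -
  have "norm (q ^ m) < 1"
    using q m by (simp add: norm_power power_less_one_iff)
  moreover have "(q ^ m)\<^sup>2 = q ^ (2 * m)"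
    by (simp add: power_mult[symmetric] mult.commute)
  moreover have "- (q ^ m / - (q ^ k / q ^ m)) = q ^ (2 * m - k)"
    using q k by (simp add: power_diff power_add mult_2)
  ultimately show ?thesis
    using jacobi_triple_product[of "q ^ m" "- (q ^ k / q ^ m)"] q by simp
qed

theorem theorem14:
  fixes q :: complex
  assumes "norm q < 1"
  shows "(\<lambda>n::nat. q ^ (n * (n + 1)) - q ^ (5 * n * (n + 1) + 1)) sums
    (qpochs_inf [q, q ^ 9, q ^ 10] (q ^ 10) * qpochs_inf [q ^ 8, q ^ 12] (q ^ 20)
      / qpochs_inf [q ^ 2, q ^ 3] (q ^ 5))"
proof (cases "q = 0")
  \<comment> \<open>The theta lemmas require a nonzero nome. For \<open>q = 0\<close> only the term
    \<open>n = 0\<close> survives, and every product has argument 0 and value 1.\<close>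
  case True
  have "(\<lambda>n::nat. q ^ (n * (n + 1)) - q ^ (5 * n * (n + 1) + 1)) = (\<lambda>n. if n = 0 then 1 else 0)"
    using True by (auto simp: fun_eq_iff)
  moreover have "(\<lambda>n::nat. if n = 0 then 1 else 0) sums (1::complex)"
    using sums_single[of 0 "\<lambda>_. 1::complex"] by simp
  moreover have "qpoch_inf 0 r = 1" for r
    by (simp add: qpoch_inf_def)
  ultimately show ?thesis
    using True by (simp add: qpochs_inf_def)
next
  case False
  have small: "norm (q ^ k) < 1" if "k > 0" for k
    using assms that by (simp add: norm_power power_less_one_iff)
  \<comment> \<open>The common atoms: every product is a monomial in \<open>D\<close>, and
    \<open>[k] = D k * D (20 - k)\<close>.\<close>
  define D where "D = (\<lambda>k::nat. qpoch_inf (q ^ k) (q ^ 20))"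
  have nz: "D k \<noteq> 0" if "k > 0" for k
    unfolding D_def using that by (intro qpoch_inf_nonzero small) auto
  have dissect: "qpoch_inf (q ^ a) (q ^ m) = (\<Prod>i<k. D (a + m * i))" if "m * k = 20" for a m k
  proof -
    have "m > 0" "k > 0"
      using that by (auto intro!: gr0I)
    then show ?thesis
      using qpoch_inf_dissect[OF small[of m], of k "q ^ a"] that
      by (simp add: D_def power_add flip: power_mult)
  qed

  note expand = lessThan_nat_numeral lessThan_Suc mult_ac
  have P44: "qpoch_inf (q ^ 4) (q ^ 4) = D 4 * D 8 * D 12 * D 16 * D 20"
    using dissect[of 4 5 4] by (simp add: expand)
  have P22: "qpoch_inf (q ^ 2) (q ^ 2) =
      D 2 * D 4 * D 6 * D 8 * D 10 * D 12 * D 14 * D 16 * D 18 * D 20"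
    using dissect[of 2 10 2] by (simp add: expand flip: numeral_2_eq_2)
  have P10: "qpoch_inf (q ^ 10) (q ^ 10) = D 10 * D 20"
    using dissect[of 10 2 10] by (simp add: expand)
  have P1: "qpoch_inf q (q ^ 10) = D 1 * D 11"
    using dissect[of 10 2 1] by (simp add: expand)
  have P9: "qpoch_inf (q ^ 9) (q ^ 10) = D 9 * D 19"
    using dissect[of 10 2 9] by (simp add: expand)
  have P2: "qpoch_inf (q ^ 2) (q ^ 5) = D 2 * D 7 * D 12 * D 17"
    using dissect[of 5 4 2] by (simp add: expand flip: numeral_2_eq_2)
  have P3: "qpoch_inf (q ^ 3) (q ^ 5) = D 3 * D 8 * D 13 * D 18"
    using dissect[of 5 4 3] by (simp add: expand)

  define T where "T = (\<lambda>z. jtheta (q ^ 10) (- (z / q ^ 10)))"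
  have T: "T (q ^ k) = D 20 * D k * D (20 - k)" if "k \<le> 20" for k
    unfolding T_def D_def using jtheta_power_eq[OF assms False, of 10 k] that by simp
  have "q ^ 8 / q ^ 4 = q ^ 4" "q ^ 5 / q ^ 2 = q ^ 3" "q ^ 8 / q ^ 2 = q ^ 6"
      "q ^ 5 / q ^ 4 = q ^ 1" "q ^ 4 / q ^ 2 = q ^ 2" "q ^ 8 / q ^ 5 = q ^ 3"
    using False by (simp_all flip: power_diff)
  \<comment> \<open>The symmetry of \<open>[k]\<close> under \<open>k\<close> to
    \<open>20 - k\<close> identifies \<open>T (q ^ 12)\<close> with \<open>T (q ^ 8)\<close> and
    \<open>T (q ^ 13)\<close> with \<open>T (q ^ 7)\<close>. So two of the three products share
    \<open>[3][7]\<close>, and the weights \<open>q ^ 4\<close>, \<open>q ^ 5\<close> leave the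
    factor \<open>q\<close>.\<close>
  then have "q ^ 4 * (T (q ^ 12) * T (q ^ 4) * T (q ^ 7) * T (q ^ 3) - T (q ^ 10) * T (q ^ 6) * T (q ^ 9) * T (q ^ 1)) =
      q ^ 5 * (T (q ^ 6) * T (q ^ 2) * T (q ^ 13) * T (q ^ 3))"
    using weierstrass_three_term[of "q ^ 10" "q ^ 8" "q ^ 4" "q ^ 5" "q ^ 2"] small[of 10] False
    by (simp add: T_def flip: power_add)
  moreover have "q ^ 5 = q ^ 4 * q"
    by (simp add: eval_nat_numeral)
  ultimately have "T (q ^ 12) * T (q ^ 4) * T (q ^ 7) * T (q ^ 3) - T (q ^ 10) * T (q ^ 6) * T (q ^ 9) * T (q ^ 1) =
      q * (T (q ^ 6) * T (q ^ 2) * T (q ^ 13) * T (q ^ 3))"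
    using False by simp
  moreover have "T (q ^ 1) = D 20 * D 1 * D 19" "T (q ^ 2) = D 20 * D 2 * D 18"
      "T (q ^ 3) = D 20 * D 3 * D 17" "T (q ^ 4) = D 20 * D 4 * D 16"
      "T (q ^ 6) = D 20 * D 6 * D 14" "T (q ^ 7) = D 20 * D 7 * D 13"
      "T (q ^ 9) = D 20 * D 9 * D 11" "T (q ^ 10) = D 20 * D 10 * D 10"
      "T (q ^ 12) = D 20 * D 12 * D 8" "T (q ^ 13) = D 20 * D 13 * D 7"
    using T[of 1] by (simp_all add: T)
  \<comment> \<open>Each product of four theta values carries \<open>D 20 ^ 4\<close>, and
    \<open>[10]\<close> is the square of \<open>D 10\<close>.\<close>
  ultimately have "D 20 ^ 4 * ((D 4 * D 8 * D 12 * D 16 - q * (D 2 * D 6 * D 14 * D 18)) * (D 3 * D 7 * D 13 * D 17)) =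
      D 20 ^ 4 * (D 1 * D 9 * D 11 * D 19 * (D 10)\<^sup>2 * (D 6 * D 14))"
    by (simp only:) (simp add: algebra_simps power2_eq_square power4_eq_xxxx)
  then have key: "(D 4 * D 8 * D 12 * D 16 - q * (D 2 * D 6 * D 14 * D 18)) * (D 3 * D 7 * D 13 * D 17) =
      D 1 * D 9 * D 11 * D 19 * (D 10)\<^sup>2 * (D 6 * D 14)"
    using nz[of 20] by (simp only: mult_cancel_left power_eq_0_iff) simp

  have S1: "(\<lambda>n. q ^ (n * (n + 1))) sums
      (D 4 * D 8 * D 12 * D 16 * D 20 / (D 2 * D 6 * D 10 * D 14 * D 18))"
    using gauss_triangular_sums[OF assms False] nz unfolding P44 P22
    by (simp add: power2_eq_square mult_ac)
  \<comment> \<open>Gauss's formula at \<open>t = q ^ 5\<close>, where the product is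
    \<open>(D 20)^2 / (D 10 * D 20)\<close>.\<close>
  have S2: "(\<lambda>n. q ^ (5 * n * (n + 1) + 1)) sums (q * (D 20 / D 10))"
  proof -
    have "qpoch_inf ((q ^ 5) ^ 4) ((q ^ 5) ^ 4) = D 20" "qpoch_inf ((q ^ 5)\<^sup>2) ((q ^ 5)\<^sup>2) = D 10 * D 20"
      using P10 by (simp_all add: D_def flip: power_mult)
    then have "(\<lambda>n. (q ^ 5) ^ (n * (n + 1))) sums (D 20 / D 10)"
      using gauss_triangular_sums[OF small[of 5]] False nz[of 20] by (simp add: power2_eq_square)
    from sums_mult[OF this, of q] show ?thesis
      by (simp add: mult.assoc flip: power_mult)
  qed
  \<comment> \<open>In bracket notation these are \<open>[4][8]\<close>, \<open>[2][6]\<close>,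
    \<open>[3][7]\<close> and \<open>[1][9]\<close>; \<open>key\<close> reads
    \<open>(X - q * Y) * K = R * [10][6]\<close>.\<close>
  define X Y K R where "X = D 4 * D 8 * D 12 * D 16" and "Y = D 2 * D 6 * D 14 * D 18"
    and "K = D 3 * D 7 * D 13 * D 17" and "R = D 1 * D 9 * D 11 * D 19"
  have XYKR: "Y \<noteq> 0" "K \<noteq> 0"
    by (simp_all add: Y_def K_def nz)
  have "D 4 * D 8 * D 12 * D 16 * D 20 / (D 2 * D 6 * D 10 * D 14 * D 18) - q * (D 20 / D 10) =
      D 20 / D 10 * ((X - q * Y) / Y)"
    unfolding X_def Y_def by (simp add: field_simps nz)
  also have "X - q * Y = R * (D 10)\<^sup>2 * (D 6 * D 14) / K"
    using key XYKR unfolding X_def Y_def K_def R_def by (simp add: eq_divide_eq)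
  also have "D 20 / D 10 * (R * (D 10)\<^sup>2 * (D 6 * D 14) / K / Y) =
      qpochs_inf [q, q ^ 9, q ^ 10] (q ^ 10) * qpochs_inf [q ^ 8, q ^ 12] (q ^ 20) / qpochs_inf [q ^ 2, q ^ 3] (q ^ 5)"
  \<comment> \<open>The factor \<open>[6]\<close> cancels against \<open>Y\<close>, leaving
    \<open>[2]\<close>. On the other side \<open>[8] = D 8 * D 12\<close> cancels against the same
    factors of the products \<open>P2\<close> and \<open>P3\<close>.\<close>
  proof -
    have "qpoch_inf (q ^ 8) (q ^ 20) = D 8" "qpoch_inf (q ^ 12) (q ^ 20) = D 12"
      by (simp_all add: D_def)
    then show ?thesis
      by (simp add: qpochs_inf_def P1 P9 P10 P2 P3 R_def K_def Y_def)
        (simp add: field_simps power2_eq_square nz)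
  qed
  finally show ?thesis
    using sums_diff[OF S1 S2] by simp
qed

end
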